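(* Let $n\ge 3$ be an integer and $r>0$. The second moment of the distance between two uniformly and independently distributed random points in the regular polygon $\mathcal{P}_{n,r}$ is $$M_2(\mathcal{P}_{n,r})=\frac{r^2}{3}\left(2+\cos\frac{2\pi}{n}\right).$$
   Context: $\mathcal{P}_{n,r}$ is the (filled) regular polygon with $n$ sides whose circumscribed circle has radius $r$. $M_m(\mathcal{P}_{n,r})=\mathbb{E}[\varDelta_{n,r}^m]$, where $\varDelta_{n,r}$ is the Euclidean distance between two points chosen independently and uniformly (w.r.t. area) from $\mathcal{P}_{n,r}$. *)

theory Defs
  imports "HOL-Probability.Probability"
begin

(* The plane is identified with complex; the polygon is placed with its centre at the origin and
   one vertex on the positive real axis. The convex hull makes it the filled polygon. *)
definition regular_polygon :: "nat \<Rightarrow> real \<Rightarrow> complex set" where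
  "regular_polygon n r = convex hull {of_real r * cis (2 * pi * real k / real n) | k. k < n}"

(* Independence of the two points is expressed by the product measure; distance_moment_indep below
   confirms that any independent uniform pair on any probability space gives the same value.
   Meaningful for Borel sets S of positive finite area. *)
definition distance_moment :: "nat \<Rightarrow> complex set \<Rightarrow> real" where
  "distance_moment m S =
     (LINT z|(uniform_measure lborel S \<Otimes>\<^sub>M uniform_measure lborel S). dist (fst z) (snd z) ^ m)"

lemma (in prob_space) distance_moment_indep:
  fixes X Y :: "'a \<Rightarrow> complex"
  assumes indep: "indep_var lborel X lborel Y"
    and X: "distr M lborel X = uniform_measure lborel S"
    and Y: "distr M lborel Y = uniform_measure lborel S"
  shows "expectation (\<lambda>\<omega>. dist (X \<omega>) (Y \<omega>) ^ m) = distance_moment m S"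
proof -
  have rv: "X \<in> measurable M lborel" "Y \<in> measurable M lborel"
    and joint: "uniform_measure lborel S \<Otimes>\<^sub>M uniform_measure lborel S =
      distr M (lborel \<Otimes>\<^sub>M lborel) (\<lambda>\<omega>. (X \<omega>, Y \<omega>))"
    using indep X Y unfolding indep_var_distribution_eq by auto
  show ?thesis
    unfolding distance_moment_def joint
    by (subst integral_distr) (use rv in \<open>auto simp: measurable_lborel1 intro!: measurable_Pair\<close>)
qed

end

theory Submission
  imports Defs
begin

text \<open>For independent, identically distributed points the mean squared distance is
  \<open>2 E|Z|\<^sup>2 - 2 |E Z|\<^sup>2\<close>. Up to the centre, the polygon is the disjoint union of \<open>n\<close> rotated copies
  of the isosceles triangle with apex \<open>0\<close>, axis along the positive reals, height
  \<open>h = r cos (\<pi>/n)\<close> and half-base \<open>h t\<close>, where \<open>t = tan (\<pi>/n)\<close>. The mean vanishes because it is a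
  multiple of a sum of equally spaced unit vectors, and \<open>E|Z|\<^sup>2\<close> is the quotient of the integral of \<open>|z|\<^sup>2\<close> over
  one triangle by its area, namely \<open>h\<^sup>2 (1 + t\<^sup>2/3) / 2\<close>.\<close>

section \<open>Lebesgue measure on the complex plane: Fubini, shears and rotations\<close>

text \<open>Lebesgue measure is determined by its values on boxes, and the preimage of a box under
  \<open>Complex\<close> is a product of two intervals. This opens the way to iterated real
  integrals.\<close>

lemma lborel_complex_eq_distr:
  "(lborel :: complex measure) = distr (lborel \<Otimes>\<^sub>M lborel) borel (\<lambda>(x, y). Complex x y)"
proof (rule lborel_eqI)
  fix l u :: complex
  assume le: "\<And>b. b \<in> Basis \<Longrightarrow> l \<bullet> b \<le> u \<bullet> b"
  have lu: "Re l \<le> Re u" "Im l \<le> Im u"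
    using le[of 1] le[of \<i>] by (auto simp: Basis_complex_def)
  have [measurable]: "(\<lambda>(x, y). Complex x y) \<in> borel \<Otimes>\<^sub>M borel \<rightarrow>\<^sub>M borel"
    unfolding borel_prod
    by (intro borel_measurable_continuous_onI) (auto simp: case_prod_unfold intro!: continuous_intros)
  have "(\<lambda>(x, y). Complex x y) -` box l u \<inter> space (lborel \<Otimes>\<^sub>M lborel)
      = {Re l<..<Re u} \<times> {Im l<..<Im u}"
    by (auto simp: box_def Basis_complex_def space_pair_measure)
  then have "emeasure (distr (lborel \<Otimes>\<^sub>M lborel) borel (\<lambda>(x, y). Complex x y)) (box l u)
      = emeasure (lborel \<Otimes>\<^sub>M lborel) ({Re l<..<Re u} \<times> {Im l<..<Im u})"
    by (subst emeasure_distr) auto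
  also have "\<dots> = ennreal (Re u - Re l) * ennreal (Im u - Im l)"
    using lu by (subst lborel.emeasure_pair_measure_Times) auto
  also have "\<dots> = ennreal (\<Prod>b\<in>Basis. (u - l) \<bullet> b)"
    using lu by (simp add: Basis_complex_def ennreal_mult')
  finally show "emeasure (distr (lborel \<Otimes>\<^sub>M lborel) borel (\<lambda>(x, y). Complex x y)) (box l u)
      = ennreal (\<Prod>b\<in>Basis. (u - l) \<bullet> b)" .
qed simp

lemma measurable_Complex [measurable (raw)]:
  assumes "f \<in> borel_measurable M" "g \<in> borel_measurable M"
  shows "(\<lambda>x. Complex (f x) (g x)) \<in> borel_measurable M"
  using assms unfolding Complex_eq by measurable

lemma nn_integral_lborel_complex:
  assumes [measurable]: "f \<in> borel_measurable borel"
  shows "(\<integral>\<^sup>+z. f z \<partial>lborel) = (\<integral>\<^sup>+x. \<integral>\<^sup>+y. f (Complex x y) \<partial>lborel \<partial>lborel)"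
  by (subst lborel_complex_eq_distr, subst nn_integral_distr)
    (auto simp: case_prod_unfold lborel.nn_integral_fst [symmetric])

text \<open>Indicator functions recover the measure of sets. Measure preservation can thus be
  checked on nonnegative integrals, where the iterated form is available.\<close>

lemma lborel_distr_eqI:
  fixes T :: "complex \<Rightarrow> complex"
  assumes [measurable]: "T \<in> borel_measurable borel"
    and "\<And>f. f \<in> borel_measurable borel \<Longrightarrow> (\<integral>\<^sup>+z. f (T z) \<partial>lborel) = (\<integral>\<^sup>+z. f z \<partial>lborel)"
  shows "distr lborel borel T = lborel"
proof (rule measure_eqI)
  fix A assume "A \<in> sets (distr lborel borel T)"
  then have [measurable]: "A \<in> sets borel" by simp
  have "emeasure (distr lborel borel T) A = (\<integral>\<^sup>+z. indicator A z \<partial>distr lborel borel T)"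
    by simp
  also have "\<dots> = (\<integral>\<^sup>+z. indicator A (T z) \<partial>lborel)"
    by (subst nn_integral_distr) auto
  also have "\<dots> = emeasure lborel A"
    by (subst assms(2)) auto
  finally show "emeasure (distr lborel borel T) A = emeasure lborel A" .
qed simp

text \<open>On each vertical line the shear is a translation, which leaves the inner integral
  unchanged.\<close>

lemma lborel_distr_shear_Im:
  "distr lborel borel (\<lambda>z. Complex (Re z) (Im z + a * Re z)) = lborel"
proof (rule lborel_distr_eqI)
  fix f :: "complex \<Rightarrow> ennreal"
  assume [measurable]: "f \<in> borel_measurable borel"
  have "(\<integral>\<^sup>+y. f (Complex x (y + a * x)) \<partial>lborel) = (\<integral>\<^sup>+y. f (Complex x y) \<partial>lborel)" for x
    by (subst (2) nn_integral_real_affine[where c = 1 and t = "a * x"]) (auto simp: add.commute)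
  then show "(\<integral>\<^sup>+z. f (Complex (Re z) (Im z + a * Re z)) \<partial>lborel) = (\<integral>\<^sup>+z. f z \<partial>lborel)"
    by (simp add: nn_integral_lborel_complex)
qed measurable

text \<open>Here the translation acts on horizontal lines, so the order of integration is exchanged
  first.\<close>

lemma lborel_distr_shear_Re:
  "distr lborel borel (\<lambda>z. Complex (Re z + a * Im z) (Im z)) = lborel"
proof (rule lborel_distr_eqI)
  fix f :: "complex \<Rightarrow> ennreal"
  assume [measurable]: "f \<in> borel_measurable borel"
  have "(\<integral>\<^sup>+x. f (Complex (x + a * y) y) \<partial>lborel) = (\<integral>\<^sup>+x. f (Complex x y) \<partial>lborel)" for y
    by (subst (2) nn_integral_real_affine[where c = 1 and t = "a * y"]) (auto simp: add.commute)
  then show "(\<integral>\<^sup>+z. f (Complex (Re z + a * Im z) (Im z)) \<partial>lborel) = (\<integral>\<^sup>+z. f z \<partial>lborel)"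
    using lborel_pair.Fubini'[of "\<lambda>x y. f (Complex (x + a * y) y)"]
      lborel_pair.Fubini'[of "\<lambda>x y. f (Complex x y)"]
    by (simp add: nn_integral_lborel_complex)
qed measurable

lemma lborel_distr_comp:
  fixes S T :: "complex \<Rightarrow> complex"
  assumes "distr lborel borel S = lborel" "distr lborel borel T = lborel"
    and "S \<in> borel_measurable borel" "T \<in> borel_measurable borel"
  shows "distr lborel borel (S \<circ> T) = lborel"
  using assms distr_distr[of S borel borel T lborel] by simp

text \<open>A rotation is a horizontal, a vertical and a horizontal shear, with factors
  \<open>- tan (\<theta> / 2)\<close>, \<open>sin \<theta>\<close>, \<open>- tan (\<theta> / 2)\<close>; where the tangent has its pole, the rotation
  is split into two half-angle ones.\<close>

lemma lborel_distr_rotation: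
  "distr lborel borel ((*) (cis \<theta>)) = lborel"
proof -
  have small: "distr lborel borel ((*) (cis \<theta>)) = lborel" if "cos (\<theta> / 2) \<noteq> 0" for \<theta>
  proof -
    let ?t = "- tan (\<theta> / 2)"
    let ?R = "\<lambda>z. Complex (Re z + ?t * Im z) (Im z)"
    let ?I = "\<lambda>z. Complex (Re z) (Im z + sin \<theta> * Re z)"
    have s: "sin \<theta> = 2 * sin (\<theta> / 2) * cos (\<theta> / 2)" and c: "cos \<theta> = 1 - 2 * (sin (\<theta> / 2))\<^sup>2"
      using sin_double[of "\<theta> / 2"] cos_double_sin[of "\<theta> / 2"] by auto
    \<comment> \<open>Facts \<open>1\<close> and \<open>2\<close> match the entries of the product
      of the three shear matrices with those of the rotation matrix: \<open>1\<close> gives the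
      diagonal, \<open>2\<close> the upper right entry.\<close>
    have 1: "cos \<theta> = 1 + ?t * sin \<theta>"
      using that by (simp add: s c tan_def power2_eq_square)
    have "2 * cos (\<theta> / 2) * cos (\<theta> / 2) = 1 + cos \<theta>"
      using cos_double_cos[of "\<theta> / 2"] by (simp add: power2_eq_square)
    then have "2 * cos (\<theta> / 2) * cos (\<theta> / 2) * sin (\<theta> / 2) = (1 + cos \<theta>) * sin (\<theta> / 2)"
      by simp
    then have 2: "?t + cos \<theta> * ?t = - sin \<theta>"
      using that by (simp add: s tan_def field_simps)
    have "(*) (cis \<theta>) = ?R \<circ> (?I \<circ> ?R)"
    proof
      fix z
      have "cos \<theta> * Re z - sin \<theta> * Im z = (1 + ?t * sin \<theta>) * Re z + (?t + (1 + ?t * sin \<theta>) * ?t) * Im z"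
        using 1 2 by simp
      moreover have "sin \<theta> * Re z + cos \<theta> * Im z = Im z + sin \<theta> * (Re z + ?t * Im z)"
        by (subst 1) (simp add: algebra_simps)
      ultimately show "cis \<theta> * z = (?R \<circ> (?I \<circ> ?R)) z"
        by (simp add: complex_eq_iff algebra_simps)
    qed
    moreover have "distr lborel borel (?R \<circ> (?I \<circ> ?R)) = lborel"
      by (intro lborel_distr_comp lborel_distr_shear_Re lborel_distr_shear_Im) measurable
    ultimately show ?thesis by simp
  qed
  show ?thesis
  proof (cases "cos (\<theta> / 2) = 0")
    case True
    \<comment> \<open>If this cosine vanished, the double-angle formula would give
      \<open>cos (\<theta> / 2) = -1\<close> instead of 0.\<close>
    then have "cos (\<theta> / 2 / 2) \<noteq> 0"
      using cos_double_cos[of "\<theta> / 2 / 2"] by auto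
    note half = small[OF this]
    have "(*) (cis \<theta>) = (*) (cis (\<theta> / 2)) \<circ> (*) (cis (\<theta> / 2))"
      by (simp add: fun_eq_iff cis_mult mult.assoc[symmetric])
    then show ?thesis
      using lborel_distr_comp[OF half half] by simp
  qed (rule small)
qed

lemma lborel_integral_rotation:
  fixes f :: "complex \<Rightarrow> 'a::{banach, second_countable_topology}"
  assumes [measurable]: "f \<in> borel_measurable borel"
  shows "(LINT z|lborel. f (cis \<theta> * z)) = (LINT z|lborel. f z)"
  by (subst (2) lborel_distr_rotation[of \<theta>, symmetric], subst integral_distr) auto

lemma lborel_integrable_rotation:
  fixes f :: "complex \<Rightarrow> 'a::{banach, second_countable_topology}"
  assumes [measurable]: "f \<in> borel_measurable borel"
  shows "integrable lborel (\<lambda>z. f (cis \<theta> * z)) \<longleftrightarrow> integrable lborel f"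
  by (subst (2) lborel_distr_rotation[of \<theta>, symmetric], subst integrable_distr_eq) auto

section \<open>Sectors and the partition of the punctured plane\<close>

text \<open>The sectors are half-open in the angle, so that their rotated copies tile the punctured plane
  exactly, without overlaps on the boundary rays.\<close>

definition sector :: "real \<Rightarrow> complex set" where
  "sector t = {w. 0 < Re w \<and> - (t * Re w) \<le> Im w \<and> Im w < t * Re w}"

text \<open>In the right half-plane the slope \<open>Im w / Re w\<close> is the tangent of the
  argument, and the tangent is increasing between -pi/2 and pi/2. The bounds on the slope are
  therefore bounds on the angle.\<close>

lemma sector_tan_iff:
  assumes "0 < \<alpha>" "\<alpha> < pi / 2"
  shows "w \<in> sector (tan \<alpha>) \<longleftrightarrow> (\<exists>\<rho>>0. \<exists>\<psi>\<in>{-\<alpha>..<\<alpha>}. w = rcis \<rho> \<psi>)"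
proof
  assume w: "w \<in> sector (tan \<alpha>)"
  then have pos: "Re w > 0" by (simp add: sector_def)
  define \<psi> where "\<psi> = arctan (Im w / Re w)"
  have "- tan \<alpha> \<le> Im w / Re w" "Im w / Re w < tan \<alpha>"
    using w pos by (auto simp: sector_def field_simps)
  then have "arctan (- tan \<alpha>) \<le> \<psi>" "\<psi> < arctan (tan \<alpha>)"
    unfolding \<psi>_def by (auto simp: arctan_le_iff arctan_less_iff simp del: arctan_minus)
  then have "\<psi> \<in> {-\<alpha>..<\<alpha>}"
    using assms by (simp add: arctan_minus arctan_tan)
  moreover have c: "cos \<psi> > 0"
    unfolding \<psi>_def by (intro cos_gt_zero_pi arctan_lbound arctan_ubound)
  moreover have "sin \<psi> / cos \<psi> = Im w / Re w"
    using tan_arctan[of "Im w / Re w"] by (simp add: \<psi>_def tan_def)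
  then have "w = rcis (Re w / cos \<psi>) \<psi>"
    using pos c by (simp add: complex_eq_iff field_simps)
  ultimately show "\<exists>\<rho>>0. \<exists>\<psi>\<in>{-\<alpha>..<\<alpha>}. w = rcis \<rho> \<psi>"
    using pos by (metis divide_pos_pos)
next
  assume "\<exists>\<rho>>0. \<exists>\<psi>\<in>{-\<alpha>..<\<alpha>}. w = rcis \<rho> \<psi>"
  then obtain \<rho> \<psi> where *: "\<rho> > 0" "-\<alpha> \<le> \<psi>" "\<psi> < \<alpha>" "w = rcis \<rho> \<psi>" by auto
  have c: "cos \<psi> > 0" using * assms by (intro cos_gt_zero_pi) auto
  then have sin: "sin \<psi> = tan \<psi> * cos \<psi>" by (simp add: tan_def)
  have "tan \<psi> < tan \<alpha>" "tan (-\<alpha>) \<le> tan \<psi>"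
    using * assms tan_monotone[of \<psi> \<alpha>] tan_mono_le[of "-\<alpha>" \<psi>] by auto
  then have "sin \<psi> < tan \<alpha> * cos \<psi>" "- (tan \<alpha> * cos \<psi>) \<le> sin \<psi>"
    using c mult_strict_right_mono[of "tan \<psi>" "tan \<alpha>" "cos \<psi>"]
      mult_right_mono[of "- tan \<alpha>" "tan \<psi>" "cos \<psi>"] by (auto simp: sin)
  from mult_strict_left_mono[OF this(1) \<open>\<rho> > 0\<close>] mult_left_mono[OF this(2), of \<rho>]
  show "w \<in> sector (tan \<alpha>)"
    using * c by (simp add: sector_def algebra_simps)
qed

text \<open>With the argument taken in [0, 2 pi), undoing the rotation turns the \<open>k\<close>-th
  condition into membership of \<open>Arg2pi z\<close> in the \<open>k\<close>-th of
  \<open>n\<close> half-open intervals of length 2 pi / n, which partition [0, 2 pi).\<close>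

lemma rotated_sectors_partition:
  assumes n: "n \<ge> 3" and z: "z \<noteq> 0"
  shows "\<exists>!k. k < n \<and> cis (- ((2 * real k + 1) * (pi / n))) * z \<in> sector (tan (pi / n))"
proof -
  define \<alpha> where "\<alpha> = pi / n"
  have "pi / n \<le> pi / 3" using n by (intro divide_left_mono) auto
  then have \<alpha>: "0 < \<alpha>" "\<alpha> < pi / 2" using n by (auto simp: \<alpha>_def field_simps)
  have n\<alpha>: "2 * \<alpha> * real n = 2 * pi" using n by (simp add: \<alpha>_def)
  have "cis (- ((2 * real k + 1) * \<alpha>)) * z \<in> sector (tan \<alpha>) \<longleftrightarrow>
      2 * \<alpha> * real k \<le> Arg2pi z \<and> Arg2pi z < 2 * \<alpha> * (real k + 1)" (is "?L \<longleftrightarrow> ?R")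
    if "k < n" for k
  proof
    assume ?L
    then obtain \<rho> \<psi> where *: "\<rho> > 0" "-\<alpha> \<le> \<psi>" "\<psi> < \<alpha>"
        "cis (- ((2 * real k + 1) * \<alpha>)) * z = rcis \<rho> \<psi>"
      using sector_tan_iff[OF \<alpha>] by auto
    have "z = cis ((2 * real k + 1) * \<alpha>) * (cis (- ((2 * real k + 1) * \<alpha>)) * z)"
      by (simp add: mult.assoc[symmetric] cis_mult)
    also have "\<dots> = of_real \<rho> * exp (\<i> * of_real (\<psi> + (2 * real k + 1) * \<alpha>))"
      unfolding * cis_conv_exp[symmetric] by (simp add: rcis_def mult.left_commute flip: cis_mult)
    finally have z_eq: "of_real \<rho> * exp (\<i> * of_real (\<psi> + (2 * real k + 1) * \<alpha>)) = z" by simp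
    \<comment> \<open>The bound \<open>k < n\<close> keeps the whole \<open>k\<close>-th angular
      interval below 2 pi, so the angle found is the value of \<open>Arg2pi\<close> itself and not a
      shift of it by a full turn.\<close>
    have "2 * \<alpha> * (real k + 1) \<le> 2 * \<alpha> * real n"
      using \<open>k < n\<close> \<alpha> by (intro mult_left_mono) auto
    then have hi: "\<psi> + (2 * real k + 1) * \<alpha> < 2 * pi"
      using * n\<alpha> by (simp add: algebra_simps)
    have "0 \<le> 2 * \<alpha> * real k" using \<alpha> by simp
    then have "0 \<le> \<psi> + (2 * real k + 1) * \<alpha>"
      using *(2) by (simp add: algebra_simps)
    from Arg2pi_unique[OF z_eq \<open>\<rho> > 0\<close> this hi] show ?R
      using * by (simp add: algebra_simps)
  next
    assume R: ?R
    have "z = rcis (norm z) (Arg2pi z)"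
      using Arg2pi[of z] by (simp add: is_Arg_def rcis_def cis_conv_exp)
    then have "cis (- ((2 * real k + 1) * \<alpha>)) * z = rcis (norm z) (Arg2pi z - (2 * real k + 1) * \<alpha>)"
      by (metis (no_types, lifting) add.commute cis_mult diff_conv_add_uminus mult.left_commute rcis_def)
    moreover have "Arg2pi z - (2 * real k + 1) * \<alpha> \<in> {-\<alpha>..<\<alpha>}"
      using R by (simp add: algebra_simps)
    ultimately show ?L
      using sector_tan_iff[OF \<alpha>] z by (metis zero_less_norm_iff)
  qed
  moreover have "\<exists>!k. k < n \<and> 2 * \<alpha> * real k \<le> Arg2pi z \<and> Arg2pi z < 2 * \<alpha> * (real k + 1)"
  proof -
    \<comment> \<open>The argument measured in sector widths; its integer part is the index
      sought.\<close>
    define x where "x = Arg2pi z / (2 * \<alpha>)"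
    have "0 \<le> x" "x < n"
      using Arg2pi[of z] \<alpha> n\<alpha> by (auto simp: x_def field_simps)
    have iff: "(2 * \<alpha> * real k \<le> Arg2pi z \<and> Arg2pi z < 2 * \<alpha> * (real k + 1)) \<longleftrightarrow> real k \<le> x \<and> x < real k + 1" for k
      using \<alpha> by (simp add: x_def field_simps)
    show ?thesis unfolding iff
    proof (rule ex1I[of _ "nat \<lfloor>x\<rfloor>"])
      show "nat \<lfloor>x\<rfloor> < n \<and> real (nat \<lfloor>x\<rfloor>) \<le> x \<and> x < real (nat \<lfloor>x\<rfloor>) + 1"
        using \<open>0 \<le> x\<close> \<open>x < n\<close> by (simp add: nat_less_iff floor_less_iff)
      show "k = nat \<lfloor>x\<rfloor>" if "k < n \<and> real k \<le> x \<and> x < real k + 1" for k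
        using that by linarith
    qed
  qed
  ultimately show ?thesis unfolding \<alpha>_def[symmetric] by (metis (no_types, lifting))
qed

section \<open>The polygon inside each sector\<close>

text \<open>The angles between edge normals and vertices are odd multiples of pi / n. An odd
  multiple is at distance at least pi / n from 0 and, in the given range, from 2 pi and -2 pi, and
  the cosine decreases on [0, pi].\<close>

lemma cos_odd_multiple_le:
  fixes i :: int
  assumes "n > 0" "odd i" "\<bar>i\<bar> < 2 * int n"
  shows "cos (of_int i * (pi / n)) \<le> cos (pi / n)"
proof -
  \<comment> \<open>Reflecting at pi folds the angle into [pi / n, pi] without changing its
    cosine.\<close>
  define j where "j = (if \<bar>i\<bar> \<le> int n then \<bar>i\<bar> else 2 * int n - \<bar>i\<bar>)"
  have "i \<noteq> 0" using assms by auto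
  then have j: "1 \<le> j" "j \<le> int n" using assms by (auto simp: j_def)
  have abs: "cos (of_int i * (pi / n)) = cos (of_int \<bar>i\<bar> * (pi / n))"
    by (cases "i \<ge> 0") (auto simp del: times_divide_eq_right)
  have "cos (of_int i * (pi / n)) = cos (of_int j * (pi / n))"
  proof (cases "\<bar>i\<bar> \<le> int n")
    case False
    then have "of_int j * (pi / n) = 2 * pi - of_int \<bar>i\<bar> * (pi / n)"
      using \<open>n > 0\<close> by (simp add: j_def field_simps)
    then show ?thesis using abs by (simp add: cos_diff)
  qed (simp add: abs j_def del: times_divide_eq_right)
  also have "\<dots> \<le> cos (pi / n)"
  proof (rule cos_monotone_0_pi_le)
    show "pi / n \<le> of_int j * (pi / n)"
      using mult_right_mono[of 1 "of_int j" "pi / n"] j by simp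
    have "of_int j \<le> real n" using j by linarith
    then show "of_int j * (pi / n) \<le> pi"
      using \<open>n > 0\<close> by (simp add: field_simps)
  qed simp
  finally show ?thesis .
qed

text \<open>The bound describes the half-plane cut off by the line through the \<open>k\<close>-th
  edge. A half-plane is convex, so only the vertices have to be checked.\<close>

lemma regular_polygon_subset_halfplane:
  assumes "n > 0" "r \<ge> 0" "k < n" "z \<in> regular_polygon n r"
  shows "Re (cis (- ((2 * real k + 1) * (pi / n))) * z) \<le> r * cos (pi / n)"
proof -
  define u where "u = cis ((2 * real k + 1) * (pi / n))"
  have inner: "Re (cis (- ((2 * real k + 1) * (pi / n))) * z) = inner u z" for z
    by (simp add: u_def inner_complex_def)
  have "regular_polygon n r \<subseteq> {z. inner u z \<le> r * cos (pi / n)}"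
    unfolding regular_polygon_def
  proof (rule hull_minimal)
    show "{of_real r * cis (2 * pi * real j / real n) |j. j < n} \<subseteq> {z. inner u z \<le> r * cos (pi / n)}"
    proof clarify
      fix j assume "j < n"
      \<comment> \<open>Vertex \<open>j\<close> has angle \<open>2 * j\<close> and the normal of
        edge \<open>k\<close> has angle \<open>2 * k + 1\<close>, in units of pi / n;
        \<open>i\<close> is their difference.\<close>
      define i where "i = 2 * (int j - int k) - 1"
      have "inner u (of_real r * cis (2 * pi * real j / real n)) =
          Re (cis (- ((2 * real k + 1) * (pi / n))) * (of_real r * cis (2 * pi * real j / real n)))"
        by (rule inner[symmetric])
      also have "\<dots> = r * Re (cis (- ((2 * real k + 1) * (pi / n))) * cis (2 * pi * real j / real n))"
        by (simp add: algebra_simps)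
      also have "cis (- ((2 * real k + 1) * (pi / n))) * cis (2 * pi * real j / real n) = cis (of_int i * (pi / n))"
        using \<open>n > 0\<close> by (simp add: cis_mult i_def field_simps)
      also have "r * Re (cis (of_int i * (pi / n))) \<le> r * cos (pi / n)"
        using assms \<open>j < n\<close> cos_odd_multiple_le[of n i]
        by (intro mult_left_mono) (auto simp: i_def)
      finally show "inner u (of_real r * cis (2 * pi * real j / real n)) \<le> r * cos (pi / n)" .
    qed
  qed (rule convex_halfspace_le)
  with assms show ?thesis unfolding inner by auto
qed

text \<open>After factoring out \<open>cis a\<close>, what remains is the sum of the
  \<open>n\<close>-th roots of unity. It serves both to locate the centre and to make the mean
  vanish.\<close>

lemma sum_cis_arithmetic_progression:
  assumes "n \<ge> 2"
  shows "(\<Sum>k<n. cis (a + 2 * pi * real k / real n)) = 0"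
proof -
  have "(\<Sum>k<n. cis (2 * pi * real k / real n)) = (\<Sum>z | z ^ n = 1. z)"
    using assms sum.reindex_bij_betw[OF Complex.bij_betw_roots_unity[of n], of "\<lambda>z. z"] by simp
  also have "\<dots> = 0" using assms by (intro sum_roots_unity) auto
  finally show ?thesis
    by (simp add: cis_mult[symmetric] sum_distrib_left[symmetric])
qed

text \<open>The centre is the average of the vertices.\<close>

lemma zero_in_regular_polygon:
  assumes "n \<ge> 2"
  shows "0 \<in> regular_polygon n r"
proof -
  define v where "v k = of_real r * cis (2 * pi * real k / real n)" for k
  have "(\<Sum>k<n. (1 / real n) *\<^sub>R v k) \<in> regular_polygon n r"
    using assms unfolding regular_polygon_def v_def
    by (intro convex_sum convex_convex_hull hull_inc) auto
  moreover have "(\<Sum>k<n. (1 / real n) *\<^sub>R v k) = 0"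
    using sum_cis_arithmetic_progression[OF assms, of 0]
    by (simp add: v_def scaleR_sum_right[symmetric] sum_distrib_left[symmetric])
  ultimately show ?thesis by simp
qed

lemma vertex_in_regular_polygon:
  assumes "k \<le> n" "n > 0"
  shows "of_real r * cis (2 * pi * real k / real n) \<in> regular_polygon n r"
proof (cases "k = n")
  case True
  then show ?thesis
    using assms unfolding regular_polygon_def by (intro hull_inc) (auto intro!: exI[of _ 0])
next
  case False
  then show ?thesis
    using assms unfolding regular_polygon_def by (intro hull_inc) auto
qed

text \<open>One direction is the half-plane bound. For the other, the point is written as a convex
  combination of the centre and the two endpoints of the \<open>k\<close>-th edge.\<close>

lemma regular_polygon_in_sector_iff:
  assumes n: "n \<ge> 3" and r: "r > 0" and k: "k < n"
    and w: "cis (- ((2 * real k + 1) * (pi / n))) * z \<in> sector (tan (pi / n))"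
  shows "z \<in> regular_polygon n r \<longleftrightarrow> Re (cis (- ((2 * real k + 1) * (pi / n))) * z) \<le> r * cos (pi / n)"
proof
  assume "z \<in> regular_polygon n r"
  then show "Re (cis (- ((2 * real k + 1) * (pi / n))) * z) \<le> r * cos (pi / n)"
    using n r k by (intro regular_polygon_subset_halfplane) auto
next
  define \<alpha> where "\<alpha> = pi / n"
  define w where "w = cis (- ((2 * real k + 1) * \<alpha>)) * z"
  have "pi / n \<le> pi / 3" using n by (intro divide_left_mono) auto
  then have \<alpha>: "0 < \<alpha>" "\<alpha> < pi / 2" using n by (auto simp: \<alpha>_def field_simps)
  have pos: "sin \<alpha> > 0" "cos \<alpha> > 0"
    using \<alpha> by (auto intro: sin_gt_zero cos_gt_zero)
  assume "Re (cis (- ((2 * real k + 1) * (pi / n))) * z) \<le> r * cos (pi / n)"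
  then have le: "Re w \<le> r * cos \<alpha>" by (simp add: w_def \<alpha>_def)
  define v where "v k = of_real r * cis (2 * pi * real k / real n)" for k
  \<comment> \<open>Coordinates of \<open>w\<close> in units of the apothem
    \<open>r * cos \<alpha>\<close> and of the half-side \<open>r * sin \<alpha>\<close>. In this
    frame the edge is \<open>A = 1\<close> and its endpoints have \<open>B = -1\<close> and
    \<open>B = 1\<close>.\<close>
  define A where "A = Re w / (r * cos \<alpha>)"
  define B where "B = Im w / (r * sin \<alpha>)"
  have ReA: "Re w = A * r * cos \<alpha>" and ImB: "Im w = B * r * sin \<alpha>"
    using pos r by (auto simp: A_def B_def)
  have "- (tan \<alpha> * Re w) \<le> Im w" "Im w < tan \<alpha> * Re w"
    using assms(4) by (auto simp: sector_def w_def \<alpha>_def)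
  then have "- A * (r * sin \<alpha>) \<le> B * (r * sin \<alpha>)" "B * (r * sin \<alpha>) < A * (r * sin \<alpha>)"
    using pos unfolding ReA ImB by (auto simp: tan_def algebra_simps)
  then have AB: "- A \<le> B" "B < A"
    using mult_pos_pos[OF r pos(1)] by (metis mult_le_cancel_right_pos, metis mult_less_cancel_right_pos)
  have A1: "A \<le> 1" using le pos r by (simp add: A_def)
  have "z = cis ((2 * real k + 1) * \<alpha>) * w"
    by (simp add: w_def mult.assoc[symmetric] cis_mult)
  also have "w = ((A - B) / 2) *\<^sub>R (of_real r * cis (- \<alpha>)) + ((A + B) / 2) *\<^sub>R (of_real r * cis \<alpha>)"
    by (simp add: complex_eq_iff ReA ImB field_simps)
  also have "cis ((2 * real k + 1) * \<alpha>) * \<dots> =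
      ((A - B) / 2) *\<^sub>R (of_real r * (cis ((2 * real k + 1) * \<alpha>) * cis (- \<alpha>)))
      + ((A + B) / 2) *\<^sub>R (of_real r * (cis ((2 * real k + 1) * \<alpha>) * cis \<alpha>))"
    by (simp add: scaleR_conv_of_real algebra_simps)
  also have "\<dots> = ((A - B) / 2) *\<^sub>R v k + ((A + B) / 2) *\<^sub>R v (Suc k)"
    unfolding cis_mult v_def by (simp add: \<alpha>_def algebra_simps add_divide_distrib)
  \<comment> \<open>Two nested convex combinations: a point of the edge, then a point between it and
    the centre. Dividing by \<open>A\<close> is sound, since \<open>- A \<le> B\<close> and
    \<open>B < A\<close> force \<open>A > 0\<close>.\<close>
  also have "\<dots> = (1 - A) *\<^sub>R 0 + A *\<^sub>R (((A - B) / (2 * A)) *\<^sub>R v k + ((A + B) / (2 * A)) *\<^sub>R v (Suc k))"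
    using AB by (simp add: scaleR_add_right)
  also have "\<dots> \<in> regular_polygon n r"
  proof (intro convexD[of "regular_polygon n r"])
    show "convex (regular_polygon n r)"
      unfolding regular_polygon_def by (rule convex_convex_hull)
    then show "convex (regular_polygon n r)" .
    show "0 \<in> regular_polygon n r" "v k \<in> regular_polygon n r" "v (Suc k) \<in> regular_polygon n r"
      unfolding v_def using n k
      by (auto intro!: zero_in_regular_polygon vertex_in_regular_polygon simp del: of_nat_Suc)
    show "(A - B) / (2 * A) + (A + B) / (2 * A) = 1"
      using AB by (simp add: field_simps)
  qed (use AB A1 in auto)
  finally show "z \<in> regular_polygon n r" .
qed

section \<open>Integrals over the reference triangle\<close>

lemma lborel_integral_complex:
  fixes f :: "complex \<Rightarrow> 'a::{banach, second_countable_topology}"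
  assumes "integrable lborel f"
  shows "(LINT z|lborel. f z) = (LINT x|lborel. LINT y|lborel. f (Complex x y))"
proof -
  have [measurable]: "f \<in> borel_measurable borel"
    using borel_measurable_integrable[OF assms] by simp
  have "integrable (lborel \<Otimes>\<^sub>M lborel) (\<lambda>p. f (case p of (x, y) \<Rightarrow> Complex x y))"
    using assms by (subst (asm) lborel_complex_eq_distr, subst (asm) integrable_distr_eq) auto
  from lborel_pair.integral_fst'[OF this] show ?thesis
    by (subst lborel_complex_eq_distr, subst integral_distr) auto
qed

text \<open>For positive \<open>h\<close> and \<open>t\<close> this is the triangle with apex 0,
  height \<open>h\<close> and half-base \<open>h * t\<close>, without its apex and its upper
  leg.\<close>

definition sector_below :: "real \<Rightarrow> real \<Rightarrow> complex set" where
  "sector_below h t = {w \<in> sector t. Re w \<le> h}"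

lemma sector_below_borel [measurable]: "sector_below h t \<in> sets borel"
  unfolding sector_below_def sector_def by measurable

lemma integrable_sector_below:
  fixes f :: "complex \<Rightarrow> 'a::{banach, second_countable_topology}"
  assumes "continuous_on UNIV f"
  shows "integrable lborel (\<lambda>w. indicator (sector_below h t) w *\<^sub>R f w)"
proof -
  have sub: "sector_below h t \<subseteq> cball 0 (h + \<bar>t\<bar> * h)"
  proof
    fix w assume "w \<in> sector_below h t"
    then have *: "0 < Re w" "Re w \<le> h" "- (t * Re w) \<le> Im w" "Im w \<le> t * Re w"
      by (auto simp: sector_below_def sector_def)
    \<comment> \<open>For negative \<open>t\<close> the sector is empty, so having a point in it
      settles the sign.\<close>
    then have "t \<ge> 0"
      by (smt (verit) mult_neg_pos)
    then have "t * Re w \<le> \<bar>t\<bar> * h"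
      using * by (intro mult_mono) auto
    then show "w \<in> cball 0 (h + \<bar>t\<bar> * h)"
      using * cmod_le[of w] by simp
  qed
  have "integrable lborel (\<lambda>w. indicator (cball 0 (h + \<bar>t\<bar> * h)) w *\<^sub>R f w)"
    by (intro borel_integrable_compact continuous_on_subset[OF assms]) auto
  then have "integrable lborel
      (\<lambda>w. indicator (sector_below h t) w *\<^sub>R (indicator (cball 0 (h + \<bar>t\<bar> * h)) w *\<^sub>R f w))"
    by (rule integrable_mult_indicator[rotated]) simp
  also have "(\<lambda>w. indicator (sector_below h t) w *\<^sub>R (indicator (cball 0 (h + \<bar>t\<bar> * h)) w *\<^sub>R f w))
      = (\<lambda>w. indicator (sector_below h t) w *\<^sub>R f w)"
    using sub by (auto simp: indicator_def fun_eq_iff)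
  finally show ?thesis .
qed

text \<open>The parameters \<open>p\<close> and \<open>q\<close> cover area and second moment in one
  computation. The vertical slice at abscissa \<open>x\<close> is the interval from
  \<open>- (t * x)\<close> to \<open>t * x\<close>, so two polynomial integrals suffice.\<close>

lemma integral_sector_below:
  assumes "h \<ge> 0" "t \<ge> 0"
  shows "(LINT w|lborel. indicator (sector_below h t) w *\<^sub>R (p + q * (norm w)\<^sup>2))
    = p * t * h ^ 2 + q * (t + t ^ 3 / 3) * h ^ 4 / 2"
proof -
  have inner: "(LINT y|lborel. indicator {-u..<u} y * (a + b * y\<^sup>2)) = 2 * u * a + 2 * b * u ^ 3 / 3"
    if "u \<ge> 0" for a b u :: real
  proof -
    \<comment> \<open>Adding the right endpoint changes the integrand on a null set only and gives
      the closed interval required by the fundamental theorem of calculus.\<close>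
    have "(LINT y|lborel. indicator {-u..<u} y * (a + b * y\<^sup>2))
        = (LINT y|lborel. (a + b * y\<^sup>2) * indicator {-u..u} y)"
      by (intro integral_cong_AE eventually_mono[OF AE_lborel_singleton[of u]])
        (auto simp: indicator_def)
    also have "\<dots> = (a * u + b * u ^ 3 / 3) - (a * (-u) + b * (-u) ^ 3 / 3)"
      using that
      by (intro integral_FTC_Icc_real)
        (auto intro!: derivative_eq_intros continuous_intros simp: power2_eq_square)
    finally show ?thesis by simp
  qed
  have outer: "(LINT x|lborel. indicator {0<..h} x * (a * x + b * x ^ 3)) = a * h ^ 2 / 2 + b * h ^ 4 / 4"
    for a b :: real
  proof -
    have "(LINT x|lborel. indicator {0<..h} x * (a * x + b * x ^ 3))
        = (LINT x|lborel. (a * x + b * x ^ 3) * indicator {0..h} x)"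
      by (intro integral_cong_AE eventually_mono[OF AE_lborel_singleton[of 0]])
        (auto simp: indicator_def)
    also have "\<dots> = (a * h ^ 2 / 2 + b * h ^ 4 / 4) - (a * 0 ^ 2 / 2 + b * 0 ^ 4 / 4)"
      using assms
      by (intro integral_FTC_Icc_real)
        (auto intro!: derivative_eq_intros continuous_intros)
    finally show ?thesis by simp
  qed
  have slice: "indicator (sector_below h t) (Complex x y) * (p + q * (norm (Complex x y))\<^sup>2)
      = indicator {0<..h} x * (indicator {-(t * x)..<t * x} y * ((p + q * x\<^sup>2) + q * y\<^sup>2))" for x y
    by (auto simp: sector_below_def sector_def indicator_def cmod_power2 algebra_simps)
  have "(LINT w|lborel. indicator (sector_below h t) w *\<^sub>R (p + q * (norm w)\<^sup>2))
      = (LINT x|lborel. indicator {0<..h} x *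
          (LINT y|lborel. indicator {-(t * x)..<t * x} y * ((p + q * x\<^sup>2) + q * y\<^sup>2)))"
    by (subst lborel_integral_complex, intro integrable_sector_below continuous_intros) (simp add: slice)
  also have "\<dots> = (LINT x|lborel. indicator {0<..h} x *
      (2 * t * p * x + (2 * t * q + 2 * q * t ^ 3 / 3) * x ^ 3))"
  proof (intro Bochner_Integration.integral_cong refl)
    fix x
    show "indicator {0<..h} x * (LINT y|lborel. indicator {-(t * x)..<t * x} y * ((p + q * x\<^sup>2) + q * y\<^sup>2))
        = indicator {0<..h} x * (2 * t * p * x + (2 * t * q + 2 * q * t ^ 3 / 3) * x ^ 3)"
    proof (cases "x \<in> {0<..h}")
      case True
      then have "t * x \<ge> 0" using assms by simp
      show ?thesis
        unfolding inner[OF \<open>t * x \<ge> 0\<close>] by (simp add: algebra_simps power2_eq_square power3_eq_cube)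
    qed simp
  qed
  also have "\<dots> = p * t * h ^ 2 + q * (t + t ^ 3 / 3) * h ^ 4 / 2"
    unfolding outer by (simp add: field_simps)
  finally show ?thesis .
qed

section \<open>Integrals over the polygon\<close>

lemma compact_regular_polygon: "compact (regular_polygon n r)"
proof -
  have "{of_real r * cis (2 * pi * real k / real n) |k. k < n} =
      (\<lambda>k. of_real r * cis (2 * pi * real k / real n)) ` {..<n}" by auto
  then show ?thesis
    unfolding regular_polygon_def by (auto intro: finite_imp_compact_convex_hull)
qed

lemma regular_polygon_borel [measurable]: "regular_polygon n r \<in> sets borel"
  by (intro borel_closed compact_imp_closed compact_regular_polygon)

text \<open>Exactly one rotated sector contains \<open>z\<close>, so all other summands vanish, and
  within that sector the polygon is cut out by the height bound. The centre is excluded because it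
  lies in no sector.\<close>

lemma indicator_regular_polygon:
  assumes n: "n \<ge> 3" and r: "r > 0" and z: "z \<noteq> 0"
  shows "indicator (regular_polygon n r) z =
    (\<Sum>k<n. indicator (sector_below (r * cos (pi / n)) (tan (pi / n)))
       (cis (- ((2 * real k + 1) * (pi / n))) * z) :: real)"
proof -
  define rot where "rot k = cis (- ((2 * real k + 1) * (pi / n))) * z" for k :: nat
  let ?T = "sector_below (r * cos (pi / n)) (tan (pi / n))"
  obtain k where k: "k < n" "rot k \<in> sector (tan (pi / n))"
    and uniq: "\<And>j. j < n \<Longrightarrow> rot j \<in> sector (tan (pi / n)) \<Longrightarrow> j = k"
    using rotated_sectors_partition[OF n z] unfolding rot_def by metis
  have "(\<Sum>j<n. indicator ?T (rot j) :: real) = (\<Sum>j\<in>{k}. indicator ?T (rot j))"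
    using k(1) uniq by (intro sum.mono_neutral_right) (auto simp: sector_below_def indicator_def)
  also have "\<dots> = indicator (regular_polygon n r) z"
    using regular_polygon_in_sector_iff[OF n r k(1), of z, folded rot_def, OF k(2)] k(2)
    by (simp add: sector_below_def indicator_def)
  finally show ?thesis by (simp add: rot_def)
qed

text \<open>The decomposition of the indicator fails at most at the centre, a null set; rotation
  invariance then carries each summand to the reference triangle.\<close>

lemma integral_regular_polygon:
  fixes f :: "complex \<Rightarrow> 'a::{banach, second_countable_topology}"
  assumes n: "n \<ge> 3" and r: "r > 0" and f: "continuous_on UNIV f"
  shows "(LINT z|lborel. indicator (regular_polygon n r) z *\<^sub>R f z) =
    (\<Sum>k<n. LINT w|lborel. indicator (sector_below (r * cos (pi / n)) (tan (pi / n))) w *\<^sub>R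
       f (cis ((2 * real k + 1) * (pi / n)) * w))"
proof -
  define a where "a k = (2 * real k + 1) * (pi / n)" for k :: nat
  let ?T = "sector_below (r * cos (pi / n)) (tan (pi / n))"
  let ?g = "\<lambda>k w. indicator ?T w *\<^sub>R f (cis (a k) * w)"
  have [measurable]: "f \<in> borel_measurable borel"
    by (rule borel_measurable_continuous_onI) fact
  \<comment> \<open>The \<open>k\<close>-th summand is \<open>?g k\<close> composed with a rotation,
    so its integrability and its integral both come from the reference triangle.\<close>
  have rot: "?g k (cis (- a k) * z) = indicator ?T (cis (- a k) * z) *\<^sub>R f z" for k z
    by (simp add: mult.assoc[symmetric] cis_mult)
  have "integrable lborel (?g k)" for k
    by (intro integrable_sector_below continuous_on_compose2[OF f] continuous_intros) auto
  then have int: "integrable lborel (\<lambda>z. indicator ?T (cis (- a k) * z) *\<^sub>R f z)" for k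
    unfolding rot[symmetric] by (subst lborel_integrable_rotation) auto
  have "(LINT z|lborel. indicator (regular_polygon n r) z *\<^sub>R f z) =
      (LINT z|lborel. (\<Sum>k<n. indicator ?T (cis (- a k) * z) *\<^sub>R f z))"
  proof (rule integral_cong_AE)
    show "AE z in lborel. indicator (regular_polygon n r) z *\<^sub>R f z =
        (\<Sum>k<n. indicator ?T (cis (- a k) * z) *\<^sub>R f z)"
      using AE_lborel_singleton[of 0]
    proof eventually_elim
      case (elim z)
      show ?case
        unfolding indicator_regular_polygon[OF n r elim] a_def by (rule scaleR_left.sum)
    qed
  qed measurable
  also have "\<dots> = (\<Sum>k<n. LINT z|lborel. indicator ?T (cis (- a k) * z) *\<^sub>R f z)"
    by (intro Bochner_Integration.integral_sum int)
  also have "\<dots> = (\<Sum>k<n. LINT w|lborel. ?g k w)"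
    unfolding rot[symmetric] by (intro sum.cong refl lborel_integral_rotation) measurable
  finally show ?thesis by (simp add: a_def)
qed

section \<open>Uniform distributions and the mean squared distance\<close>

lemma integral_uniform_measure:
  fixes f :: "'a \<Rightarrow> 'b::{banach, second_countable_topology}"
  assumes "emeasure M A \<noteq> 0" "emeasure M A \<noteq> \<infinity>" and [measurable]: "f \<in> borel_measurable M"
  shows "integral\<^sup>L (uniform_measure M A) f = (LINT x|M. indicator A x *\<^sub>R f x) /\<^sub>R measure M A"
proof -
  have [measurable]: "A \<in> sets M" using assms(1) by (rule emeasure_neq_0_sets)
  have eq: "emeasure M A = ennreal (measure M A)"
    using assms(2) by (simp add: emeasure_eq_ennreal_measure)
  then have "measure M A > 0" using assms(1) by (simp add: zero_less_measure_iff)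
  then have "uniform_measure M A = density M (\<lambda>x. ennreal (indicator A x / measure M A))"
    unfolding uniform_measure_def eq
    by (intro density_cong) (auto simp: indicator_def divide_ennreal ennreal_1[symmetric] simp del: ennreal_1)
  then show ?thesis
    by (simp add: integral_density divide_inverse_commute scaleR_scaleR[symmetric] del: scaleR_scaleR)
qed

text \<open>Expand the squared distance and integrate over one point at a time: the cross term is
  linear in each point and becomes the squared norm of the mean. The almost sure bound supplies the
  integrability for Fubini.\<close>

lemma integral_dist_squared_pair:
  fixes M :: "'a::euclidean_space measure"
  assumes prob: "prob_space M" and sets: "sets M = sets borel"
    and bound: "AE x in M. norm x \<le> R"
  shows "(LINT z|(M \<Otimes>\<^sub>M M). (dist (fst z) (snd z))\<^sup>2)
    = 2 * (LINT x|M. (norm x)\<^sup>2) - 2 * (norm (LINT x|M. x))\<^sup>2"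
proof -
  interpret M: prob_space M by (rule prob)
  interpret pair_prob_space M M ..
  note [measurable_cong] = sets
  have i1: "integrable M (\<lambda>x. x)"
    by (rule M.integrable_const_bound[OF bound]) measurable
  have i2: "integrable M (\<lambda>x. (norm x)\<^sup>2)"
    by (rule M.integrable_const_bound[where B = "R\<^sup>2"])
      (use bound in \<open>auto elim!: eventually_mono intro: power_mono\<close>)
  have "AE z in M \<Otimes>\<^sub>M M. norm (fst z) \<le> R \<and> norm (snd z) \<le> R"
  proof (rule AE_pair_measure)
    show "AE x in M. AE y in M. norm (fst (x, y)) \<le> R \<and> norm (snd (x, y)) \<le> R"
      using bound by (auto elim!: eventually_mono)
  qed measurable
  then have "AE z in M \<Otimes>\<^sub>M M. norm ((dist (fst z) (snd z))\<^sup>2) \<le> (2 * R)\<^sup>2"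
  proof eventually_elim
    case (elim z)
    then have "dist (fst z) (snd z) \<le> 2 * R"
      using norm_triangle_ineq4[of "fst z" "snd z"] by (simp add: dist_norm)
    then show ?case
      using power_mono[of "dist (fst z) (snd z)" "2 * R" 2] by simp
  qed
  then have "integrable (M \<Otimes>\<^sub>M M) (\<lambda>z. (dist (fst z) (snd z))\<^sup>2)"
    by (rule P.integrable_const_bound) measurable
  from integral_fst'[OF this]
  have "(LINT z|(M \<Otimes>\<^sub>M M). (dist (fst z) (snd z))\<^sup>2) = (LINT x|M. LINT y|M. (dist x y)\<^sup>2)"
    by simp
  also have "\<dots> = (LINT x|M. (norm x)\<^sup>2 - 2 * inner x (LINT y|M. y) + (LINT y|M. (norm y)\<^sup>2))"
  proof (intro Bochner_Integration.integral_cong refl)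
    fix x :: 'a
    have "(dist x y)\<^sup>2 = (norm x)\<^sup>2 - 2 * inner x y + (norm y)\<^sup>2" for y
      by (simp add: dist_norm power2_norm_eq_inner inner_diff inner_commute algebra_simps)
    then show "(LINT y|M. (dist x y)\<^sup>2)
        = (norm x)\<^sup>2 - 2 * inner x (LINT y|M. y) + (LINT y|M. (norm y)\<^sup>2)"
      using i1 i2 by (simp add: M.prob_space)
  qed
  also have "\<dots> = 2 * (LINT x|M. (norm x)\<^sup>2) - 2 * (norm (LINT x|M. x))\<^sup>2"
    using i1 i2 by (simp add: M.prob_space power2_norm_eq_inner)
  finally show ?thesis .
qed

section \<open>Area, second moment and mean of the polygon\<close>

theorem theorem4:
  fixes n :: nat and r :: real
  assumes "n \<ge> 3" and "r > 0"
  shows "distance_moment 2 (regular_polygon n r) = r\<^sup>2 / 3 * (2 + cos (2 * pi / real n))"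
proof -
  let ?P = "regular_polygon n r" and ?\<alpha> = "pi / real n"
  define h where "h = r * cos ?\<alpha>"
  define t where "t = tan ?\<alpha>"
  let ?T = "sector_below h t"
  have "pi / n \<le> pi / 3" using assms by (intro divide_left_mono) auto
  then have \<alpha>: "0 < ?\<alpha>" "?\<alpha> < pi / 2" using assms by (auto simp: field_simps)
  have pos: "cos ?\<alpha> > 0" "t > 0"
    using \<alpha> by (auto simp: t_def intro: cos_gt_zero tan_gt_zero)
  then have "h > 0" using assms by (simp add: h_def)
  note decomposition = integral_regular_polygon[OF assms, folded h_def t_def]

  have "(LINT z|lborel. indicator ?P z *\<^sub>R (1::real)) = n * (t * h\<^sup>2)"
    using pos \<open>h > 0\<close> integral_sector_below[of h t 1 0] by (subst decomposition) auto
  then have area: "measure lborel ?P = n * (t * h\<^sup>2)" by simp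
  \<comment> \<open>Rotations preserve the norm, so the \<open>n\<close> triangles contribute
    equally.\<close>
  have second: "(LINT z|lborel. indicator ?P z *\<^sub>R (norm z)\<^sup>2) = n * ((t + t ^ 3 / 3) * h ^ 4 / 2)"
    using pos \<open>h > 0\<close> integral_sector_below[of h t 0 1]
    by (subst decomposition) (auto simp: norm_mult intro!: continuous_intros)
  \<comment> \<open>Each triangle contributes the same vector, rotated to the axis of its sector;
    these directions are equally spaced and cancel.\<close>
  have "(LINT z|lborel. indicator ?P z *\<^sub>R z)
      = (\<Sum>k<n. cis ((2 * real k + 1) * ?\<alpha>) * (LINT w|lborel. indicator ?T w *\<^sub>R w))"
    by (subst decomposition)
      (auto intro!: continuous_intros sum.cong
        simp flip: mult_scaleR_right Bochner_Integration.integral_mult_right_zero)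
  also have "\<dots> = (\<Sum>k<n. cis (?\<alpha> + 2 * pi * real k / real n)) * (LINT w|lborel. indicator ?T w *\<^sub>R w)"
    unfolding sum_distrib_right
    by (intro sum.cong refl) (simp add: algebra_simps add_divide_distrib)
  also have "\<dots> = 0"
    using assms by (simp add: sum_cis_arithmetic_progression)
  finally have mean: "(LINT z|lborel. indicator ?P z *\<^sub>R z) = 0" .

  have "measure lborel ?P \<noteq> 0" using area pos \<open>h > 0\<close> assms by simp
  then have fin: "emeasure lborel ?P \<noteq> 0" "emeasure lborel ?P \<noteq> \<infinity>"
    using emeasure_compact_finite[OF compact_regular_polygon[of n r]] by (auto simp: measure_def)
  have prob: "prob_space (uniform_measure lborel ?P)"
    by (rule prob_space_uniform_measure) (use fin in auto)
  obtain R where "\<forall>z\<in>?P. norm z \<le> R"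
    using compact_imp_bounded[OF compact_regular_polygon[of n r]] by (auto simp: bounded_iff)
  then have bound: "AE z in uniform_measure lborel ?P. norm z \<le> R"
    by (intro AE_uniform_measureI) auto
  have "(LINT z|uniform_measure lborel ?P. (norm z)\<^sup>2) = n * ((t + t ^ 3 / 3) * h ^ 4 / 2) / (n * (t * h\<^sup>2))"
    by (subst integral_uniform_measure[OF fin]) (simp_all only: second area, auto simp: field_simps)
  moreover have "(LINT z|uniform_measure lborel ?P. z) = 0"
    by (subst integral_uniform_measure[OF fin]) (auto simp: mean)
  ultimately have "distance_moment 2 ?P = 2 * (n * ((t + t ^ 3 / 3) * h ^ 4 / 2) / (n * (t * h\<^sup>2)))"
    unfolding distance_moment_def
    by (subst integral_dist_squared_pair[OF prob _ bound]) simp_all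
  also have "\<dots> = h\<^sup>2 * (1 + t\<^sup>2 / 3)"
    using pos \<open>h > 0\<close> assms
    by (simp add: field_simps power2_eq_square power3_eq_cube power4_eq_xxxx)
  \<comment> \<open>Here \<open>h = r * cos ?\<alpha>\<close> is the apothem and
    \<open>h * t = r * sin ?\<alpha>\<close> the half-side.\<close>
  also have "\<dots> = r\<^sup>2 / 3 * (3 * (cos ?\<alpha>)\<^sup>2 + (sin ?\<alpha>)\<^sup>2)"
    using pos(1) by (simp add: h_def t_def tan_def field_simps power2_eq_square)
  also have "3 * (cos ?\<alpha>)\<^sup>2 + (sin ?\<alpha>)\<^sup>2 = 2 + cos (2 * pi / real n)"
    using cos_double_cos[of ?\<alpha>] sin_cos_squared_add[of ?\<alpha>] by simp
  finally show ?thesis .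
qed

end
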